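(* Let $k$ be a field, let $Q$ be an arbitrary quiver, and consider the representation $\mathcal{N}$ of the Leavitt path algebra $L_k(Q)$ on the vector space with basis the set of all finite paths in $Q$ that terminate at a sink. Let $Q_0^s$ be the set of sinks of $Q$. Then the following statements hold. (1) For each $i\in Q_0^s$, the subspace $\mathcal{N}_i\subseteq\mathcal{N}$ is an irreducible subrepresentation, and it satisfies ${\rm End}_{L_k(Q)}(\mathcal{N}_i)\simeq k$. (2) For $i,j\in Q_0^s$, the two representations $\mathcal{N}_i$ and $\mathcal{N}_j$ are isomorphic if and only if $i=j$. (3) For any tail-equivalence class $[p]\in\widetilde{Q}_\infty$ of left-infinite paths and any $i\in Q_0^s$, the representation $\mathcal{F}_{[p]}$ is not isomorphic to $\mathcal{N}_i$.
   Context: A quiver $Q=(Q_0,Q_1;s,t)$ consists of a set $Q_0$ of vertices, a set $Q_1$ of arrows and maps $s,t\colon Q_1\to Q_0$ (starting and terminating vertex). A vertex is a sink if no arrow starts at it, an infinite emitter if infinitely many arrows start at it, and regular if it is neither. A finite path of length $n\ge1$ is a sequence $p=\alpha_n\cdots\alpha_2\alpha_1$ of arrows with $t(\alpha_i)=s(\alpha_{i+1})$; $s(p)=s(\alpha_1)$, $t(p)=t(\alpha_n)$; for each vertex $i$ there is a trivial path $e_i$ of length $0$ with $s(e_i)=t(e_i)=i$. Concatenation is written from right to left: $pq$ is defined when $s(p)=t(q)$. Leavitt path algebra: $L_k(Q)$ is the $k$-algebra (algebras are not required to be unital) given by generators $\{e_i,\alpha,\alpha^*\mid i\in Q_0,\alpha\in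 Q_1\}$ subject to: (0) $e_ie_j=\delta_{ij}e_i$ for $i,j\in Q_0$; (1) $e_{t(\alpha)}\alpha=\alpha=\alpha e_{s(\alpha)}$; (2) $e_{s(\alpha)}\alpha^*=\alpha^*=\alpha^*e_{t(\alpha)}$; (3) $\alpha\beta^*=\delta_{\alpha,\beta}e_{t(\alpha)}$ for $\alpha,\beta\in Q_1$; (4) $\sum_{\{\alpha\in Q_1\mid s(\alpha)=i\}}\alpha^*\alpha=e_i$ for every regular vertex $i$. A representation of $L_k(Q)$ is a $k$-vector space $M$ with an algebra homomorphism $L_k(Q)\to{\rm End}_k(M)$; it is irreducible if it is nonzero and has no subrepresentations other than $0$ and itself. $\mathcal{N}$ is the $k$-vector space with basis the finite paths terminating at a sink (trivial paths at sinks included); $L_k(Q)$ acts as follows: $e_i.p=\delta_{i,s(p)}p$; $\alpha.p=0$ if $p$ has length $0$, and $\alpha.p=\delta_{\alpha,\alpha_1}\,\alpha_n\cdots\alpha_2$ for $p=\alpha_n\cdots\alpha_2\alpha_1$ (read as $e_{t(\alpha_1)}$ when $n=1$); $\alpha^*.p=p\alpha$ if $t(\alpha)=s(p)$ and $\alpha^*.p=0$ otherwise. For a sink $i$, $\mathcal{N}_i$ is the subspace spanned by the paths $p$ with $t(p)=i$. A left-infinite path is an infinite sequence $p=\cdots\alpha_n\cdots\alpha_2\alpha_1$ of arrows with $t(\alpha_i)=s(\alpha_{i+1})$ for all $i\ge1$; $s(p)=s(\alpha_1)$; $Q_\infty$ is the set of them. For $n\ge0$, $\tau_{>n}(p)=\cdots\alpha_{n+2}\alpha_{n+1}$.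 Left-infinite paths $p,q$ are tail-equivalent if $\tau_{>n}(p)=\tau_{>m}(q)$ for some $n,m\ge0$; $[p]$ is the class of $p$ and $\widetilde{Q}_\infty$ the set of classes. $\mathcal{F}$ is the $k$-vector space with basis $Q_\infty$, with action, for $p=\cdots\alpha_2\alpha_1$: $e_i.p=\delta_{i,s(p)}p$; $\alpha.p=\delta_{\alpha,\alpha_1}\tau_{>1}(p)$; $\alpha^*.p=p\alpha$ if $t(\alpha)=s(p)$ and $0$ otherwise. $\mathcal{F}_{[p]}$ is the subrepresentation spanned by $\{q\mid q\in[p]\}$. *)

theory Defs
  imports
    "Graph_Theory.Arc_Walk"
    "HOL-Library.FuncSet"
    "HOL-Library.Poly_Mapping"
begin

section \<open>Vector spaces with a given basis\<close>

text \<open>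
  \<open>'b \<Rightarrow>\<^sub>0 'k\<close> is the vector space with basis \<open>'b\<close>; the basis vector belonging to \<open>x\<close> is
  \<open>Poly_Mapping.single x 1\<close>.
\<close>

definition pm_scale :: "'k::field \<Rightarrow> ('b \<Rightarrow>\<^sub>0 'k) \<Rightarrow> ('b \<Rightarrow>\<^sub>0 'k)" where
  "pm_scale c f = Poly_Mapping.map (\<lambda>x. c * x) f"

lemma lookup_pm_scale [simp]:
  "Poly_Mapping.lookup (pm_scale c f) x = c * Poly_Mapping.lookup f x"
  unfolding pm_scale_def by (auto simp: Poly_Mapping.map.rep_eq when_def)

global_interpretation pm: vector_space pm_scale
  by standard (auto intro!: poly_mapping_eqI simp: lookup_add algebra_simps)

definition basis_span :: "'b set \<Rightarrow> ('b \<Rightarrow>\<^sub>0 'k::field) set" where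
  "basis_span B = pm.span ((\<lambda>x. Poly_Mapping.single x 1) ` B)"

definition lin_ext :: "('b \<Rightarrow> ('c \<Rightarrow>\<^sub>0 'k::field)) \<Rightarrow> ('b \<Rightarrow>\<^sub>0 'k) \<Rightarrow> ('c \<Rightarrow>\<^sub>0 'k)" where
  "lin_ext b f = (\<Sum>x\<in>Poly_Mapping.keys f. pm_scale (Poly_Mapping.lookup f x) (b x))"

section \<open>Algebras and representations\<close>

text \<open>Algebras need not be unital, so there is no field for a unit.\<close>

record ('k, 'x) kalgebra =
  alg_carrier :: "'x set"
  alg_add :: "'x \<Rightarrow> 'x \<Rightarrow> 'x"
  alg_scale :: "'k \<Rightarrow> 'x \<Rightarrow> 'x"
  alg_mult :: "'x \<Rightarrow> 'x \<Rightarrow> 'x"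

definition alg_hom :: "('k, 'x) kalgebra \<Rightarrow> ('k, 'y) kalgebra \<Rightarrow> ('x \<Rightarrow> 'y) set" where
  "alg_hom A B = {h \<in> funcset (alg_carrier A) (alg_carrier B).
     (\<forall>x\<in>alg_carrier A. \<forall>y\<in>alg_carrier A. h (alg_add A x y) = alg_add B (h x) (h y)) \<and>
     (\<forall>c. \<forall>x\<in>alg_carrier A. h (alg_scale A c x) = alg_scale B c (h x)) \<and>
     (\<forall>x\<in>alg_carrier A. \<forall>y\<in>alg_carrier A. h (alg_mult A x y) = alg_mult B (h x) (h y))}"

definition alg_isomorphic :: "('k, 'x) kalgebra \<Rightarrow> ('k, 'y) kalgebra \<Rightarrow> bool" where
  "alg_isomorphic A B \<longleftrightarrow>
     (\<exists>h\<in>alg_hom A B. bij_betw h (alg_carrier A) (alg_carrier B))"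

definition field_algebra :: "('k::field, 'k) kalgebra" where
  "field_algebra = \<lparr>alg_carrier = UNIV, alg_add = (+), alg_scale = (*), alg_mult = (*)\<rparr>"

text \<open>
  Linear maps between subspaces \<open>V\<close> and \<open>W\<close> of two ambient vector spaces are extensional functions,
  so that equality of functions is equality of linear maps.
\<close>

definition lin_maps ::
  "('k \<Rightarrow> 'm \<Rightarrow> 'm::ab_group_add) \<Rightarrow> 'm set \<Rightarrow> ('k \<Rightarrow> 'n \<Rightarrow> 'n::ab_group_add) \<Rightarrow> 'n set
    \<Rightarrow> ('m \<Rightarrow> 'n) set" where
  "lin_maps s V t W = {f \<in> V \<rightarrow>\<^sub>E W.
     (\<forall>x\<in>V. \<forall>y\<in>V. f (x + y) = f x + f y) \<and> (\<forall>c. \<forall>x\<in>V. f (s c x) = t c (f x))}"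

definition End_algebra :: "('k \<Rightarrow> 'm \<Rightarrow> 'm::ab_group_add) \<Rightarrow> 'm set \<Rightarrow> ('k, 'm \<Rightarrow> 'm) kalgebra" where
  "End_algebra s V = \<lparr>
     alg_carrier = lin_maps s V s V,
     alg_add = (\<lambda>f g. \<lambda>x\<in>V. f x + g x),
     alg_scale = (\<lambda>c f. \<lambda>x\<in>V. s c (f x)),
     alg_mult = compose V\<rparr>"

record ('k, 'x, 'm) rep =
  rep_scale :: "'k \<Rightarrow> 'm \<Rightarrow> 'm"
  rep_space :: "'m set"
  rep_act :: "'x \<Rightarrow> 'm \<Rightarrow> 'm"

definition is_representation ::
  "('k::field, 'x) kalgebra \<Rightarrow> ('k, 'x, 'm::ab_group_add) rep \<Rightarrow> bool" where
  "is_representation A M \<longleftrightarrow>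
     vector_space (rep_scale M) \<and> module.subspace (rep_scale M) (rep_space M) \<and>
     rep_act M \<in> alg_hom A (End_algebra (rep_scale M) (rep_space M))"

definition subrepresentation ::
  "('k::field, 'x) kalgebra \<Rightarrow> ('k, 'x, 'm::ab_group_add) rep \<Rightarrow> 'm set \<Rightarrow> bool" where
  "subrepresentation A M W \<longleftrightarrow>
     is_representation A M \<and> module.subspace (rep_scale M) W \<and> W \<subseteq> rep_space M \<and>
     (\<forall>a\<in>alg_carrier A. \<forall>w\<in>W. rep_act M a w \<in> W)"

definition subrep :: "('k, 'x, 'm) rep \<Rightarrow> 'm set \<Rightarrow> ('k, 'x, 'm) rep" where
  "subrep M W = \<lparr>rep_scale = rep_scale M, rep_space = W, rep_act = (\<lambda>a. restrict (rep_act M a) W)\<rparr>"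

definition irreducible_rep ::
  "('k::field, 'x) kalgebra \<Rightarrow> ('k, 'x, 'm::ab_group_add) rep \<Rightarrow> bool" where
  "irreducible_rep A M \<longleftrightarrow>
     is_representation A M \<and> rep_space M \<noteq> {0} \<and>
     (\<forall>W. subrepresentation A M W \<longrightarrow> W = {0} \<or> W = rep_space M)"

definition rep_hom ::
  "('k, 'x) kalgebra \<Rightarrow> ('k, 'x, 'm::ab_group_add) rep \<Rightarrow> ('k, 'x, 'n::ab_group_add) rep
    \<Rightarrow> ('m \<Rightarrow> 'n) set" where
  "rep_hom A M N = {f \<in> lin_maps (rep_scale M) (rep_space M) (rep_scale N) (rep_space N).
     \<forall>a\<in>alg_carrier A. \<forall>x\<in>rep_space M. f (rep_act M a x) = rep_act N a (f x)}"

definition rep_isomorphic ::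
  "('k, 'x) kalgebra \<Rightarrow> ('k, 'x, 'm::ab_group_add) rep \<Rightarrow> ('k, 'x, 'n::ab_group_add) rep \<Rightarrow> bool" where
  "rep_isomorphic A M N \<longleftrightarrow> (\<exists>f\<in>rep_hom A M N. bij_betw f (rep_space M) (rep_space N))"

definition End_rep ::
  "('k, 'x) kalgebra \<Rightarrow> ('k, 'x, 'm::ab_group_add) rep \<Rightarrow> ('k, 'm \<Rightarrow> 'm) kalgebra" where
  "End_rep A M = (End_algebra (rep_scale M) (rep_space M))\<lparr>alg_carrier := rep_hom A M M\<rparr>"

section \<open>Leavitt path algebras\<close>

text \<open>
  A quiver is a \<open>wf_digraph\<close>: loops, multiple arrows, and infinite or empty sets of vertices and
  arrows are allowed. The starting vertex of an arrow is its \<open>tail\<close>, the terminating vertex its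
  \<open>head\<close>.
\<close>

definition sinks :: "('v, 'a) pre_digraph \<Rightarrow> 'v set" where
  "sinks Q = {i \<in> verts Q. out_arcs Q i = {}}"

definition regular_verts :: "('v, 'a) pre_digraph \<Rightarrow> 'v set" where
  "regular_verts Q = {i \<in> verts Q. out_arcs Q i \<noteq> {} \<and> finite (out_arcs Q i)}"

datatype 'g free_monoid = Word (letters: "'g list")

instantiation free_monoid :: (type) monoid_add
begin

definition "0 = Word []"
definition "u + w = Word (letters u @ letters w)"

instance
  by standard (auto simp: zero_free_monoid_def plus_free_monoid_def)

end

datatype ('v, 'a) lpa_gen = Vertex 'v | Arrow 'a | Ghost 'a

type_synonym ('v, 'a, 'k) free_lpa = "('v, 'a) lpa_gen free_monoid \<Rightarrow>\<^sub>0 'k"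

definition lpa_gens :: "('v, 'a) pre_digraph \<Rightarrow> ('v, 'a) lpa_gen set" where
  "lpa_gens Q = Vertex ` verts Q \<union> Arrow ` arcs Q \<union> Ghost ` arcs Q"

text \<open>
  With the convolution product, \<open>('v, 'a, 'k) free_lpa\<close> is a free unital algebra. The free algebra
  without unit on the generators of \<open>Q\<close> is spanned by the nonempty words in these generators.
\<close>

definition free_carrier :: "('v, 'a) pre_digraph \<Rightarrow> ('v, 'a, 'k::field) free_lpa set" where
  "free_carrier Q =
     {f. \<forall>w\<in>Poly_Mapping.keys f. letters w \<noteq> [] \<and> set (letters w) \<subseteq> lpa_gens Q}"

definition gen :: "('v, 'a) lpa_gen \<Rightarrow> ('v, 'a, 'k::field) free_lpa" where
  "gen g = Poly_Mapping.single (Word [g]) 1"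

inductive_set lpa_relators :: "('v, 'a) pre_digraph \<Rightarrow> ('v, 'a, 'k::field) free_lpa set"
  for Q :: "('v, 'a) pre_digraph" where
  vertex: "\<lbrakk>i \<in> verts Q; j \<in> verts Q\<rbrakk> \<Longrightarrow>
    gen (Vertex i) * gen (Vertex j) - (if i = j then gen (Vertex i) else 0) \<in> lpa_relators Q"
| arrow_left: "\<alpha> \<in> arcs Q \<Longrightarrow>
    gen (Vertex (head Q \<alpha>)) * gen (Arrow \<alpha>) - gen (Arrow \<alpha>) \<in> lpa_relators Q"
| arrow_right: "\<alpha> \<in> arcs Q \<Longrightarrow>
    gen (Arrow \<alpha>) * gen (Vertex (tail Q \<alpha>)) - gen (Arrow \<alpha>) \<in> lpa_relators Q"
| ghost_left: "\<alpha> \<in> arcs Q \<Longrightarrow>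
    gen (Vertex (tail Q \<alpha>)) * gen (Ghost \<alpha>) - gen (Ghost \<alpha>) \<in> lpa_relators Q"
| ghost_right: "\<alpha> \<in> arcs Q \<Longrightarrow>
    gen (Ghost \<alpha>) * gen (Vertex (head Q \<alpha>)) - gen (Ghost \<alpha>) \<in> lpa_relators Q"
| arrow_ghost: "\<lbrakk>\<alpha> \<in> arcs Q; \<beta> \<in> arcs Q\<rbrakk> \<Longrightarrow>
    gen (Arrow \<alpha>) * gen (Ghost \<beta>) - (if \<alpha> = \<beta> then gen (Vertex (head Q \<alpha>)) else 0)
      \<in> lpa_relators Q"
| regular: "i \<in> regular_verts Q \<Longrightarrow>
    (\<Sum>\<alpha>\<in>out_arcs Q i. gen (Ghost \<alpha>) * gen (Arrow \<alpha>)) - gen (Vertex i) \<in> lpa_relators Q"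

inductive_set lpa_ideal :: "('v, 'a) pre_digraph \<Rightarrow> ('v, 'a, 'k::field) free_lpa set"
  for Q :: "('v, 'a) pre_digraph" where
  relator: "r \<in> lpa_relators Q \<Longrightarrow> r \<in> lpa_ideal Q"
| zero: "0 \<in> lpa_ideal Q"
| add: "\<lbrakk>x \<in> lpa_ideal Q; y \<in> lpa_ideal Q\<rbrakk> \<Longrightarrow> x + y \<in> lpa_ideal Q"
| scale: "x \<in> lpa_ideal Q \<Longrightarrow> pm_scale c x \<in> lpa_ideal Q"
| mult_left: "\<lbrakk>a \<in> free_carrier Q; x \<in> lpa_ideal Q\<rbrakk> \<Longrightarrow> a * x \<in> lpa_ideal Q"
| mult_right: "\<lbrakk>x \<in> lpa_ideal Q; a \<in> free_carrier Q\<rbrakk> \<Longrightarrow> x * a \<in> lpa_ideal Q"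

definition lpa_rel :: "('v, 'a) pre_digraph \<Rightarrow> ('v, 'a, 'k::field) free_lpa rel" where
  "lpa_rel Q = {(f, g). f \<in> free_carrier Q \<and> g \<in> free_carrier Q \<and> f - g \<in> lpa_ideal Q}"

definition leavitt_path_algebra ::
  "('v, 'a) pre_digraph \<Rightarrow> ('k::field, ('v, 'a, 'k) free_lpa set) kalgebra" where
  "leavitt_path_algebra Q = \<lparr>
     alg_carrier = free_carrier Q // lpa_rel Q,
     alg_add = (\<lambda>X Y. \<Union>x\<in>X. \<Union>y\<in>Y. lpa_rel Q `` {x + y}),
     alg_scale = (\<lambda>c X. \<Union>x\<in>X. lpa_rel Q `` {pm_scale c x}),
     alg_mult = (\<lambda>X Y. \<Union>x\<in>X. \<Union>y\<in>Y. lpa_rel Q `` {x * y})\<rparr>"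

text \<open>
  The action of the Leavitt path algebra determined by operators \<open>ops g\<close> for the generators \<open>g\<close>: a
  word \<open>g\<^sub>1\<dots>g\<^sub>n\<close> acts by \<open>ops g\<^sub>1 \<circ> \<dots> \<circ> ops g\<^sub>n\<close>. When the operators satisfy the defining relations on
  \<open>V\<close>, all elements of a residue class act on \<open>V\<close> by the same map, which \<open>the_elem\<close> picks out
  (see \<open>representation_lpa_rep\<close> below).
\<close>

definition eval_free ::
  "(('v, 'a) lpa_gen \<Rightarrow> ('b \<Rightarrow>\<^sub>0 'k) \<Rightarrow> ('b \<Rightarrow>\<^sub>0 'k)) \<Rightarrow> ('v, 'a, 'k::field) free_lpa
    \<Rightarrow> ('b \<Rightarrow>\<^sub>0 'k) \<Rightarrow> ('b \<Rightarrow>\<^sub>0 'k)" where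
  "eval_free ops f v = lin_ext (\<lambda>w. foldr ops (letters w) v) f"

definition lpa_rep ::
  "(('v, 'a) lpa_gen \<Rightarrow> ('b \<Rightarrow>\<^sub>0 'k) \<Rightarrow> ('b \<Rightarrow>\<^sub>0 'k)) \<Rightarrow> ('b \<Rightarrow>\<^sub>0 'k) set
    \<Rightarrow> ('k::field, ('v, 'a, 'k) free_lpa set, 'b \<Rightarrow>\<^sub>0 'k) rep" where
  "lpa_rep ops V = \<lparr>
     rep_scale = pm_scale,
     rep_space = V,
     rep_act = (\<lambda>X. the_elem ((\<lambda>f. restrict (eval_free ops f) V) ` X))\<rparr>"

section \<open>The representations \<open>\<N>\<close> and \<open>\<F>\<close>\<close>

text \<open>
  A finite path \<open>\<alpha>\<^sub>n\<dots>\<alpha>\<^sub>1\<close> starting at \<open>u\<close> is the pair \<open>(u, [\<alpha>\<^sub>1, \<dots>, \<alpha>\<^sub>n])\<close>; the first component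
  distinguishes the trivial paths \<open>(u, [])\<close>.
\<close>

definition paths_to :: "('v, 'a) pre_digraph \<Rightarrow> 'v \<Rightarrow> ('v \<times> 'a list) set" where
  "paths_to Q i = {(u, p). pre_digraph.awalk Q u p i}"

fun fin_basis_act ::
  "('v, 'a) pre_digraph \<Rightarrow> ('v, 'a) lpa_gen \<Rightarrow> 'v \<times> 'a list \<Rightarrow> ('v \<times> 'a list \<Rightarrow>\<^sub>0 'k::field)" where
  "fin_basis_act Q (Vertex i) (u, p) = (if i = u then Poly_Mapping.single (u, p) 1 else 0)"
| "fin_basis_act Q (Arrow \<alpha>) (u, []) = 0"
| "fin_basis_act Q (Arrow \<alpha>) (u, \<beta> # p) =
     (if \<alpha> = \<beta> then Poly_Mapping.single (head Q \<beta>, p) 1 else 0)"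
| "fin_basis_act Q (Ghost \<alpha>) (u, p) =
     (if head Q \<alpha> = u then Poly_Mapping.single (tail Q \<alpha>, \<alpha> # p) 1 else 0)"

definition N_rep ::
  "('v, 'a) pre_digraph \<Rightarrow> ('k::field, ('v, 'a, 'k) free_lpa set, 'v \<times> 'a list \<Rightarrow>\<^sub>0 'k) rep" where
  "N_rep Q = lpa_rep (\<lambda>g. lin_ext (fin_basis_act Q g)) (basis_span (\<Union>i\<in>sinks Q. paths_to Q i))"

definition N_space :: "('v, 'a) pre_digraph \<Rightarrow> 'v \<Rightarrow> ('v \<times> 'a list \<Rightarrow>\<^sub>0 'k::field) set" where
  "N_space Q i = basis_span (paths_to Q i)"

text \<open>A left-infinite path \<open>\<dots>\<alpha>\<^sub>2\<alpha>\<^sub>1\<close> is the function \<open>p\<close> with \<open>p n = \<alpha>\<^sub>n\<^sub>+\<^sub>1\<close>.\<close>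

definition inf_paths :: "('v, 'a) pre_digraph \<Rightarrow> (nat \<Rightarrow> 'a) set" where
  "inf_paths Q = {p. \<forall>n. p n \<in> arcs Q \<and> head Q (p n) = tail Q (p (Suc n))}"

definition path_tail :: "nat \<Rightarrow> (nat \<Rightarrow> 'a) \<Rightarrow> (nat \<Rightarrow> 'a)" where
  "path_tail n p = (\<lambda>k. p (n + k))"

definition tail_equiv :: "('v, 'a) pre_digraph \<Rightarrow> (nat \<Rightarrow> 'a) rel" where
  "tail_equiv Q = {(p, q). p \<in> inf_paths Q \<and> q \<in> inf_paths Q \<and>
     (\<exists>n m. path_tail n p = path_tail m q)}"

fun inf_basis_act ::
  "('v, 'a) pre_digraph \<Rightarrow> ('v, 'a) lpa_gen \<Rightarrow> (nat \<Rightarrow> 'a) \<Rightarrow> ((nat \<Rightarrow> 'a) \<Rightarrow>\<^sub>0 'k::field)" where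
  "inf_basis_act Q (Vertex i) p = (if i = tail Q (p 0) then Poly_Mapping.single p 1 else 0)"
| "inf_basis_act Q (Arrow \<alpha>) p =
     (if \<alpha> = p 0 then Poly_Mapping.single (path_tail 1 p) 1 else 0)"
| "inf_basis_act Q (Ghost \<alpha>) p =
     (if head Q \<alpha> = tail Q (p 0) then Poly_Mapping.single (case_nat \<alpha> p) 1 else 0)"

definition F_rep ::
  "('v, 'a) pre_digraph \<Rightarrow> ('k::field, ('v, 'a, 'k) free_lpa set, (nat \<Rightarrow> 'a) \<Rightarrow>\<^sub>0 'k) rep" where
  "F_rep Q = lpa_rep (\<lambda>g. lin_ext (inf_basis_act Q g)) (basis_span (inf_paths Q))"

section \<open>Well-definedness\<close>

lemma lin_ext_superset:
  assumes "finite S" "Poly_Mapping.keys f \<subseteq> S"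
  shows "lin_ext b f = (\<Sum>x\<in>S. pm_scale (Poly_Mapping.lookup f x) (b x))"
  unfolding lin_ext_def using assms
  by (intro sum.mono_neutral_left) (auto simp: in_keys_iff)

lemma lin_ext_zero [simp]: "lin_ext b 0 = 0"
  by (simp add: lin_ext_def)

lemma lin_ext_add: "lin_ext b (f + g) = lin_ext b f + lin_ext b g"
proof -
  define S where "S = Poly_Mapping.keys f \<union> Poly_Mapping.keys g"
  have S: "finite S" "Poly_Mapping.keys f \<subseteq> S" "Poly_Mapping.keys g \<subseteq> S"
    "Poly_Mapping.keys (f + g) \<subseteq> S"
    using keys_add[of f g] by (auto simp: S_def)
  show ?thesis
    by (simp add: lin_ext_superset[OF S(1)] S lookup_add pm.scale_left_distrib sum.distrib)
qed

lemma lin_ext_scale: "lin_ext b (pm_scale c f) = pm_scale c (lin_ext b f)"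
proof -
  have "Poly_Mapping.keys (pm_scale c f) \<subseteq> Poly_Mapping.keys f"
    by (auto simp: in_keys_iff)
  then show ?thesis
    by (simp add: lin_ext_superset[of "Poly_Mapping.keys f" "pm_scale c f"] lin_ext_def[of b f]
        pm.scale_sum_right)
qed

lemma lin_ext_minus: "lin_ext b (f - g) = lin_ext b f - lin_ext b g"
  using lin_ext_add[of b "f - g" g] by simp

lemma lin_ext_sum: "lin_ext b (sum f S) = (\<Sum>x\<in>S. lin_ext b (f x))"
  by (induction S rule: infinite_finite_induct) (auto simp: lin_ext_add)

lemma lin_ext_single [simp]: "lin_ext b (Poly_Mapping.single x c) = pm_scale c (b x)"
  by (cases "c = 0") (auto simp: lin_ext_def)

lemma eq_lin_ext_single: "f = lin_ext (\<lambda>x. Poly_Mapping.single x 1) f"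
proof (rule poly_mapping_eqI)
  fix x
  show "Poly_Mapping.lookup f x = Poly_Mapping.lookup (lin_ext (\<lambda>x. Poly_Mapping.single x 1) f) x"
    by (simp add: lin_ext_def lookup_sum lookup_single when_def in_keys_iff if_distrib[of "(*) _"]
        cong: if_cong)
qed

lemma basis_span_iff: "f \<in> basis_span B \<longleftrightarrow> Poly_Mapping.keys f \<subseteq> B"
proof
  assume "f \<in> basis_span B"
  then show "Poly_Mapping.keys f \<subseteq> B"
    unfolding basis_span_def
  proof (induction rule: pm.span_induct_alt)
    case base
    show ?case by simp
  next
    case (step c x y)
    then show ?case
      by (fastforce simp: in_keys_iff lookup_add lookup_single when_def split: if_splits)
  qed
next
  assume "Poly_Mapping.keys f \<subseteq> B"
  then have "lin_ext (\<lambda>x. Poly_Mapping.single x 1) f \<in> basis_span B"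
    unfolding lin_ext_def basis_span_def
    by (intro pm.span_sum pm.span_scale pm.span_base) auto
  then show "f \<in> basis_span B"
    using eq_lin_ext_single[of f] by simp
qed

lemma subspace_basis_span: "pm.subspace (basis_span B)"
  unfolding basis_span_def by (rule pm.subspace_span)

lemma lin_ext_in_subspace:
  assumes "pm.subspace V" "\<And>x. x \<in> Poly_Mapping.keys f \<Longrightarrow> b x \<in> V"
  shows "lin_ext b f \<in> V"
  unfolding lin_ext_def using assms by (intro pm.subspace_sum pm.subspace_scale) auto

lemma pm_scale_mult_left: "pm_scale c f * g = pm_scale c (f * g)"
  unfolding pm_scale_def mult_map_scale_conv_mult by (simp add: mult.assoc)

lemma free_carrier_add: "\<lbrakk>f \<in> free_carrier Q; g \<in> free_carrier Q\<rbrakk> \<Longrightarrow> f + g \<in> free_carrier Q"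
  using keys_add[of f g] unfolding free_carrier_def by blast

lemma free_carrier_scale: "f \<in> free_carrier Q \<Longrightarrow> pm_scale c f \<in> free_carrier Q"
  unfolding free_carrier_def by (auto simp: in_keys_iff)

lemma free_carrier_mult:
  fixes f g :: "('v, 'a, 'k::field) free_lpa"
  assumes "f \<in> free_carrier Q" "g \<in> free_carrier Q"
  shows "f * g \<in> free_carrier Q"
  unfolding free_carrier_def
proof safe
  fix w assume "w \<in> Poly_Mapping.keys (f * g)"
  then obtain u v where uv: "w = u + v" "u \<in> Poly_Mapping.keys f" "v \<in> Poly_Mapping.keys g"
    using keys_mult[of f g] by blast
  then show "letters w = [] \<Longrightarrow> False" and "\<And>x. x \<in> set (letters w) \<Longrightarrow> x \<in> lpa_gens Q"
    using assms by (auto simp: free_carrier_def plus_free_monoid_def)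
qed

lemma gen_in_free_carrier: "g \<in> lpa_gens Q \<Longrightarrow> gen g \<in> free_carrier Q"
  by (auto simp: free_carrier_def gen_def)

lemma equiv_lpa_rel:
  fixes Q :: "('v, 'a) pre_digraph"
  shows "equiv (free_carrier Q :: ('v, 'a, 'k::field) free_lpa set) (lpa_rel Q)" (is "equiv ?F ?r")
proof (rule equivI)
  show "?r \<subseteq> ?F \<times> ?F"
    by (auto simp: lpa_rel_def)
  show "refl_on ?F ?r"
    by (auto simp: refl_on_def lpa_rel_def lpa_ideal.zero)
  show "sym ?r"
  proof (rule symI)
    fix f g :: "('v, 'a, 'k) free_lpa"
    assume "(f, g) \<in> ?r"
    then show "(g, f) \<in> ?r"
      using lpa_ideal.scale[of "f - g" Q "-1"] by (auto simp: lpa_rel_def)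
  qed
  show "trans ?r"
  proof (rule transI)
    fix f g h :: "('v, 'a, 'k) free_lpa"
    assume "(f, g) \<in> ?r" "(g, h) \<in> ?r"
    then show "(f, h) \<in> ?r"
      using lpa_ideal.add[of "f - g" Q "g - h"] by (auto simp: lpa_rel_def)
  qed
qed

lemma congruent2_lpa_add:
  fixes Q :: "('v, 'a) pre_digraph"
  shows "congruent2 (lpa_rel Q) (lpa_rel Q)
    (\<lambda>x y :: ('v, 'a, 'k::field) free_lpa. lpa_rel Q `` {x + y})"
proof (rule congruent2I')
  fix x x' y y' :: "('v, 'a, 'k) free_lpa"
  assume *: "(x, x') \<in> lpa_rel Q" "(y, y') \<in> lpa_rel Q"
  have "(x + y, x' + y') \<in> lpa_rel Q"
    using * lpa_ideal.add[of "x - x'" Q "y - y'"]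
    by (auto simp: lpa_rel_def free_carrier_add algebra_simps)
  then show "lpa_rel Q `` {x + y} = lpa_rel Q `` {x' + y'}"
    by (rule equiv_class_eq[OF equiv_lpa_rel])
qed

lemma congruent_lpa_scale:
  fixes Q :: "('v, 'a) pre_digraph"
  shows "congruent (lpa_rel Q) (\<lambda>x :: ('v, 'a, 'k::field) free_lpa. lpa_rel Q `` {pm_scale c x})"
proof (rule congruentI)
  fix x x' :: "('v, 'a, 'k) free_lpa"
  assume *: "(x, x') \<in> lpa_rel Q"
  have "(pm_scale c x, pm_scale c x') \<in> lpa_rel Q"
    using * lpa_ideal.scale[of "x - x'" Q c]
    by (auto simp: lpa_rel_def free_carrier_scale pm.scale_right_diff_distrib)
  then show "lpa_rel Q `` {pm_scale c x} = lpa_rel Q `` {pm_scale c x'}"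
    by (rule equiv_class_eq[OF equiv_lpa_rel])
qed

lemma congruent2_lpa_mult:
  fixes Q :: "('v, 'a) pre_digraph"
  shows "congruent2 (lpa_rel Q) (lpa_rel Q)
    (\<lambda>x y :: ('v, 'a, 'k::field) free_lpa. lpa_rel Q `` {x * y})"
proof (rule congruent2I')
  fix x x' y y' :: "('v, 'a, 'k) free_lpa"
  assume *: "(x, x') \<in> lpa_rel Q" "(y, y') \<in> lpa_rel Q"
  have "(x - x') * y + x' * (y - y') \<in> lpa_ideal Q"
    using * by (intro lpa_ideal.add lpa_ideal.mult_left lpa_ideal.mult_right) (auto simp: lpa_rel_def)
  then have "(x * y, x' * y') \<in> lpa_rel Q"
    using * by (auto simp: lpa_rel_def free_carrier_mult algebra_simps)
  then show "lpa_rel Q `` {x * y} = lpa_rel Q `` {x' * y'}"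
    by (rule equiv_class_eq[OF equiv_lpa_rel])
qed

locale lpa_basis_operators =
  fixes b :: "('v, 'a) lpa_gen \<Rightarrow> 'b \<Rightarrow> ('b \<Rightarrow>\<^sub>0 'k::field)"
begin

abbreviation "ops \<equiv> \<lambda>g. lin_ext (b g)"
abbreviation "ev \<equiv> eval_free ops"

lemma word_add: "foldr ops gs (u + v) = foldr ops gs u + foldr ops gs v"
  by (induction gs) (auto simp: lin_ext_add)

lemma word_scale: "foldr ops gs (pm_scale c v) = pm_scale c (foldr ops gs v)"
  by (induction gs) (auto simp: lin_ext_scale)

lemma ev_add_left: "ev (f + g) v = ev f v + ev g v"
  by (simp add: eval_free_def lin_ext_add)

lemma ev_minus_left: "ev (f - g) v = ev f v - ev g v"
  by (simp add: eval_free_def lin_ext_minus)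

lemma ev_scale_left: "ev (pm_scale c f) v = pm_scale c (ev f v)"
  by (simp add: eval_free_def lin_ext_scale)

lemma ev_add: "ev f (u + v) = ev f u + ev f v"
  by (simp add: eval_free_def lin_ext_def word_add pm.scale_right_distrib sum.distrib)

lemma ev_scale: "ev f (pm_scale c v) = pm_scale c (ev f v)"
  by (simp add: eval_free_def lin_ext_def word_scale pm.scale_sum_right mult.commute)

lemma ev_zero: "ev f 0 = 0"
  using ev_scale[of f 0 0] by simp

lemma ev_sum: "ev f (sum h S) = (\<Sum>x\<in>S. ev f (h x))"
  by (induction S rule: infinite_finite_induct) (auto simp: ev_add ev_zero)

lemma ev_single: "ev (Poly_Mapping.single w c) v = pm_scale c (foldr ops (letters w) v)"
  by (simp add: eval_free_def)

lemma ev_sum_left: "ev (sum h S) v = (\<Sum>x\<in>S. ev (h x) v)"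
  by (simp add: eval_free_def lin_ext_sum)

lemma eq_sum_single:
  fixes f :: "'c \<Rightarrow>\<^sub>0 'k"
  shows "f = (\<Sum>w\<in>Poly_Mapping.keys f. Poly_Mapping.single w (Poly_Mapping.lookup f w))"
  by (rule poly_mapping_eqI) (simp add: lookup_sum lookup_single when_def in_keys_iff cong: if_cong)

lemma ev_mult: "ev (f * g) v = ev f (ev g v)"
proof -
  have "ev (Poly_Mapping.single u c * Poly_Mapping.single w d) v
      = ev (Poly_Mapping.single u c) (ev (Poly_Mapping.single w d) v)" for u w c d
    by (simp add: mult_single ev_single plus_free_monoid_def word_scale)
  then have *: "ev (Poly_Mapping.single u c * g) v = ev (Poly_Mapping.single u c) (ev g v)" for u c
    by (subst (1 2) eq_sum_single[of g]) (simp add: sum_distrib_left ev_sum_left ev_sum)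
  show ?thesis
    by (subst (1 2) eq_sum_single[of f]) (simp add: sum_distrib_right ev_sum_left *)
qed

lemma ev_gen: "ev (gen g) v = lin_ext (b g) v"
  by (simp add: gen_def ev_single)

end

text \<open>
  The universal property of the Leavitt path algebra, for operators on \<open>'b \<Rightarrow>\<^sub>0 'k\<close> given on the
  basis that satisfy the defining relations on the subspace \<open>V\<close>.
\<close>

locale lpa_operators = lpa_basis_operators b
  for b :: "('v, 'a) lpa_gen \<Rightarrow> 'b \<Rightarrow> ('b \<Rightarrow>\<^sub>0 'k::field)" +
  fixes Q :: "('v, 'a) pre_digraph"
    and V :: "('b \<Rightarrow>\<^sub>0 'k) set"
  assumes subspace: "pm.subspace V"
    and invariant: "\<lbrakk>g \<in> lpa_gens Q; v \<in> V\<rbrakk> \<Longrightarrow> lin_ext (b g) v \<in> V"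
    and relations: "\<lbrakk>r \<in> lpa_relators Q; v \<in> V\<rbrakk> \<Longrightarrow> ev r v = 0"
begin

lemma word_in: "\<lbrakk>set gs \<subseteq> lpa_gens Q; v \<in> V\<rbrakk> \<Longrightarrow> foldr ops gs v \<in> V"
  by (induction gs) (auto intro: invariant)

lemma ev_in:
  assumes "f \<in> free_carrier Q" "v \<in> V"
  shows "ev f v \<in> V"
  unfolding eval_free_def
  using assms by (intro lin_ext_in_subspace[OF subspace] word_in) (auto simp: free_carrier_def)

lemma ev_ideal:
  assumes "x \<in> lpa_ideal Q" "v \<in> V"
  shows "ev x v = 0"
  using assms
proof (induction arbitrary: v)
  case (relator r)
  then show ?case by (rule relations)
next
  case zero
  show ?case by (simp add: eval_free_def)
next
  case (mult_right x a)
  then show ?case by (simp add: ev_mult ev_in)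
qed (simp_all add: ev_add_left ev_scale_left ev_mult ev_zero)

lemma rep_act_eq:
  assumes X: "X \<in> free_carrier Q // lpa_rel Q" and f: "f \<in> X"
  shows "rep_act (lpa_rep ops V) X = restrict (ev f) V"
proof -
  have eq: "restrict (ev g) V = restrict (ev f) V" if g: "g \<in> X" for g
  proof (rule restrict_ext)
    fix v assume v: "v \<in> V"
    have "(g, f) \<in> lpa_rel Q"
      using quotient_eq_iff[OF equiv_lpa_rel X X g f] by simp
    then have "g - f \<in> lpa_ideal Q"
      by (simp add: lpa_rel_def)
    then have "ev (g - f) v = 0"
      using v by (rule ev_ideal)
    then show "ev g v = ev f v"
      by (simp add: ev_minus_left)
  qed
  have "(\<lambda>f. restrict (ev f) V) ` X = (\<lambda>_. restrict (ev f) V) ` X"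
    by (rule image_cong[OF refl eq])
  also have "\<dots> = {restrict (ev f) V}"
    using f by (rule image_constant)
  finally show ?thesis
    by (simp add: lpa_rep_def)
qed

lemma rep_act_class:
  "f \<in> free_carrier Q \<Longrightarrow> rep_act (lpa_rep ops V) (lpa_rel Q `` {f}) = restrict (ev f) V"
  by (rule rep_act_eq[OF quotientI equiv_class_self[OF equiv_lpa_rel]])

lemma rep_act_gen:
  assumes "g \<in> lpa_gens Q" "v \<in> V"
  shows "rep_act (lpa_rep ops V) (lpa_rel Q `` {gen g}) v = lin_ext (b g) v"
  using assms by (simp add: rep_act_class gen_in_free_carrier ev_gen)

lemma representation_lpa_rep: "is_representation (leavitt_path_algebra Q) (lpa_rep ops V)"
proof -
  let ?F = "free_carrier Q :: ('v, 'a, 'k) free_lpa set"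
  let ?r = "lpa_rel Q :: ('v, 'a, 'k) free_lpa rel"
  let ?A = "rep_act (lpa_rep ops V)"
  let ?L = "leavitt_path_algebra Q :: ('k, ('v, 'a, 'k) free_lpa set) kalgebra"
  let ?E = "End_algebra pm_scale V"
  have mem: "?A X \<in> lin_maps pm_scale V pm_scale V" if X: "X \<in> ?F // ?r" for X
  proof -
    obtain f where f: "f \<in> ?F" "X = ?r `` {f}"
      using X by (rule quotientE)
    show ?thesis
      using f subspace
      by (auto simp: rep_act_class lin_maps_def ev_in ev_add ev_scale pm.subspace_add pm.subspace_scale)
  qed
  have add: "?A (alg_add ?L X Y) = alg_add ?E (?A X) (?A Y)"
    and mult: "?A (alg_mult ?L X Y) = alg_mult ?E (?A X) (?A Y)"
    if XY: "X \<in> ?F // ?r" "Y \<in> ?F // ?r" for X Y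
  proof -
    obtain f where f: "f \<in> ?F" "X = ?r `` {f}" using XY(1) by (rule quotientE)
    obtain g where g: "g \<in> ?F" "Y = ?r `` {g}" using XY(2) by (rule quotientE)
    note fg = f g
    have "alg_add ?L X Y = ?r `` {f + g}" "alg_mult ?L X Y = ?r `` {f * g}"
      using fg
      by (simp_all add: leavitt_path_algebra_def
          UN_equiv_class2[OF equiv_lpa_rel equiv_lpa_rel congruent2_lpa_add]
          UN_equiv_class2[OF equiv_lpa_rel equiv_lpa_rel congruent2_lpa_mult])
    then show "?A (alg_add ?L X Y) = alg_add ?E (?A X) (?A Y)"
      and "?A (alg_mult ?L X Y) = alg_mult ?E (?A X) (?A Y)"
      using fg
      by (auto simp: rep_act_class free_carrier_add free_carrier_mult ev_add_left ev_mult ev_in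
          End_algebra_def compose_def intro!: restrict_ext)
  qed
  have scale: "?A (alg_scale ?L c X) = alg_scale ?E c (?A X)" if X: "X \<in> ?F // ?r" for c X
  proof -
    obtain f where f: "f \<in> ?F" "X = ?r `` {f}"
      using X by (rule quotientE)
    have "alg_scale ?L c X = ?r `` {pm_scale c f}"
      using f by (simp add: leavitt_path_algebra_def UN_equiv_class[OF equiv_lpa_rel congruent_lpa_scale])
    then show ?thesis
      using f by (auto simp: rep_act_class free_carrier_scale ev_scale_left End_algebra_def
          intro!: restrict_ext)
  qed
  have "?A \<in> alg_hom ?L ?E"
    using mem add mult scale
    by (auto simp: alg_hom_def End_algebra_def leavitt_path_algebra_def)
  then show ?thesis
    using subspace pm.vector_space_axioms by (simp add: is_representation_def lpa_rep_def)
qed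

lemma invariant_imp_subrepresentation:
  assumes "pm.subspace W" "W \<subseteq> V" "\<And>g v. \<lbrakk>g \<in> lpa_gens Q; v \<in> W\<rbrakk> \<Longrightarrow> lin_ext (b g) v \<in> W"
  shows "subrepresentation (leavitt_path_algebra Q) (lpa_rep ops V) W"
proof -
  interpret W: lpa_operators b Q W
    using assms relations by unfold_locales auto
  have "rep_act (lpa_rep ops V) X w \<in> W" if X: "X \<in> free_carrier Q // lpa_rel Q" and w: "w \<in> W" for X w
  proof -
    obtain f where f: "f \<in> free_carrier Q" "X = lpa_rel Q `` {f}"
      using X by (rule quotientE)
    then show ?thesis
      using w assms(2) by (auto simp: rep_act_class W.ev_in)
  qed
  then show ?thesis
    using assms representation_lpa_rep
    by (auto simp: subrepresentation_def lpa_rep_def leavitt_path_algebra_def)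
qed

end

lemma (in lpa_basis_operators) lpa_operatorsI:
  assumes inv: "\<And>g x. \<lbrakk>g \<in> lpa_gens Q; x \<in> B\<rbrakk> \<Longrightarrow> b g x \<in> basis_span B"
    and rel: "\<And>r x. \<lbrakk>r \<in> lpa_relators Q; x \<in> B\<rbrakk> \<Longrightarrow> ev r (Poly_Mapping.single x 1) = 0"
  shows "lpa_operators b Q (basis_span B)"
proof
  show "pm.subspace (basis_span B)" by (rule subspace_basis_span)
  show "lin_ext (b g) v \<in> basis_span B" if "g \<in> lpa_gens Q" "v \<in> basis_span B" for g v
    using that inv by (intro lin_ext_in_subspace subspace_basis_span) (auto simp: basis_span_iff)
  show "ev r v = 0" if r: "r \<in> lpa_relators Q" and v: "v \<in> basis_span B" for r v
  proof -
    have "ev r (lin_ext (\<lambda>x. Poly_Mapping.single x 1) v) = 0"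
      using rel[OF r] v
      by (auto simp: lin_ext_def[of _ v] ev_sum ev_scale basis_span_iff intro!: sum.neutral)
    then show ?thesis
      using eq_lin_ext_single[of v] by simp
  qed
qed

lemma single_in_basis_span [simp]:
  "Poly_Mapping.single x (1::'k::field) \<in> basis_span B \<longleftrightarrow> x \<in> B"
  by (simp add: basis_span_iff)

lemma zero_in_basis_span [simp]: "0 \<in> basis_span B"
  by (simp add: basis_span_iff)

lemma fin_basis_act_closed:
  assumes "wf_digraph Q" "g \<in> lpa_gens Q" "x \<in> paths_to Q i"
  shows "fin_basis_act Q g x \<in> basis_span (paths_to Q i)"
proof -
  obtain u p where "x = (u, p)" by force
  then show ?thesis
    using assms(2,3)
    by (cases g; cases p)
       (auto simp: paths_to_def lpa_gens_def wf_digraph.awalk_Cons_iff[OF assms(1)])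
qed

lemma lpa_operators_N:
  assumes "wf_digraph Q"
  shows "lpa_operators (fin_basis_act Q :: _ \<Rightarrow> _ \<Rightarrow> (_ \<Rightarrow>\<^sub>0 'k::field)) Q
    (basis_span (\<Union>i\<in>sinks Q. paths_to Q i))"
proof (rule lpa_basis_operators.lpa_operatorsI)
  interpret wf_digraph Q by fact
  interpret b: lpa_basis_operators "fin_basis_act Q :: _ \<Rightarrow> _ \<Rightarrow> (_ \<Rightarrow>\<^sub>0 'k)" .
  let ?B = "\<Union>i\<in>sinks Q. paths_to Q i"
  show "fin_basis_act Q g x \<in> basis_span ?B" if "g \<in> lpa_gens Q" "x \<in> ?B" for g x
    using fin_basis_act_closed[OF assms that(1), of x] that(2)
    by (fastforce simp: basis_span_iff)
  show "b.ev r (Poly_Mapping.single x 1) = 0" if r: "r \<in> lpa_relators Q" and x: "x \<in> ?B" for r x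
  proof -
    obtain u p where up: "x = (u, p)" by force
    from x up obtain s where s: "s \<in> sinks Q" "awalk u p s" by (auto simp: paths_to_def)
    note ev = b.ev_minus_left b.ev_mult b.ev_gen b.ev_sum_left up
    show ?thesis
      using r
    proof cases
      case (regular i)
      show ?thesis
      proof (cases p)
        case Nil
        then have "u \<noteq> i"
          using s regular by (auto simp: sinks_def regular_verts_def awalk_Nil_iff)
        then show ?thesis
          using Nil regular by (simp add: ev eval_free_def[of _ 0])
      next
        case (Cons \<beta> ps)
        have "(\<Sum>\<alpha>\<in>out_arcs Q i. b.ops (Ghost \<alpha>) (b.ops (Arrow \<alpha>) (Poly_Mapping.single (u, \<beta> # ps) 1)))
          = (\<Sum>\<alpha>\<in>out_arcs Q i. if \<alpha> = \<beta> then Poly_Mapping.single (tail Q \<beta>, \<beta> # ps) (1::'k) else 0)"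
          by (rule sum.cong) auto
        then show ?thesis
          using Cons regular s
          by (auto simp: ev regular_verts_def awalk_Cons_iff)
      qed
    qed (cases p; use s in \<open>auto simp: ev awalk_Cons_iff eval_free_def[of _ 0]\<close>)+
  qed
qed

lemma subrepresentation_N:
  assumes "wf_digraph Q" "i \<in> sinks Q"
  shows "subrepresentation (leavitt_path_algebra Q) (N_rep Q) (N_space Q i)"
proof -
  interpret lpa_operators "fin_basis_act Q" Q "basis_span (\<Union>i\<in>sinks Q. paths_to Q i)"
    by (rule lpa_operators_N[OF assms(1)])
  have "lin_ext (fin_basis_act Q g) v \<in> basis_span (paths_to Q i)"
    if "g \<in> lpa_gens Q" "v \<in> basis_span (paths_to Q i)" for g v
    using that by (intro lin_ext_in_subspace subspace_basis_span fin_basis_act_closed assms)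
      (auto simp: basis_span_iff)
  moreover have "basis_span (paths_to Q i) \<subseteq> basis_span (\<Union>i\<in>sinks Q. paths_to Q i)"
    using assms(2) unfolding subset_iff basis_span_iff by blast
  ultimately show ?thesis
    unfolding N_rep_def N_space_def
    by (intro invariant_imp_subrepresentation subspace_basis_span)
qed

lemma all_nat_split: "(\<forall>n. P n) \<longleftrightarrow> P 0 \<and> (\<forall>n. P (Suc n))"
  by (metis not0_implies_Suc)

lemma case_nat_in_inf_paths:
  "case_nat \<alpha> p \<in> inf_paths Q \<longleftrightarrow> \<alpha> \<in> arcs Q \<and> p \<in> inf_paths Q \<and> head Q \<alpha> = tail Q (p 0)"
  unfolding inf_paths_def mem_Collect_eq by (subst all_nat_split) auto

lemma path_tail_in_inf_paths: "p \<in> inf_paths Q \<Longrightarrow> path_tail n p \<in> inf_paths Q"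
  by (auto simp: inf_paths_def path_tail_def)

lemma path_tail_case_nat [simp]: "path_tail (Suc 0) (case_nat \<alpha> p) = p"
  by (simp add: path_tail_def)

lemma case_nat_path_tail [simp]: "case_nat (p 0) (path_tail (Suc 0) p) = p"
  by (auto simp: path_tail_def fun_eq_iff split: nat.splits)

lemma path_tail_path_tail: "path_tail n (path_tail m p) = path_tail (m + n) p"
  by (simp add: path_tail_def add.assoc)

lemma equiv_tail_equiv: "equiv (inf_paths Q) (tail_equiv Q)"
proof (rule equivI)
  show "trans (tail_equiv Q)"
  proof (rule transI)
    fix p q r assume "(p, q) \<in> tail_equiv Q" "(q, r) \<in> tail_equiv Q"
    then obtain n m k l where *: "p \<in> inf_paths Q" "r \<in> inf_paths Q"
      "path_tail n p = path_tail m q" "path_tail k q = path_tail l r"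
      by (auto simp: tail_equiv_def)
    have "path_tail (n + k) p = path_tail (l + m) r"
      using *(3,4) by (metis add.commute path_tail_path_tail)
    then show "(p, r) \<in> tail_equiv Q" using * by (auto simp: tail_equiv_def)
  qed
qed (auto simp: tail_equiv_def refl_on_def sym_def, metis+)

lemma inf_basis_act_closed:
  assumes "g \<in> lpa_gens Q" "p \<in> c" "c \<in> inf_paths Q // tail_equiv Q"
  shows "inf_basis_act Q g p \<in> basis_span c"
proof -
  have p: "p \<in> inf_paths Q"
    using assms(2,3) equiv_tail_equiv[of Q] by (meson in_quotient_imp_subset subsetD)
  have closed: "q \<in> c" if "(p, q) \<in> tail_equiv Q" for q
    using in_quotient_imp_closed[OF equiv_tail_equiv assms(3,2) that] .
  have "path_tail (Suc 0) p = path_tail 0 (path_tail (Suc 0) p)"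
    by (simp add: path_tail_path_tail)
  then have "path_tail (Suc 0) p \<in> c"
    using p path_tail_in_inf_paths[OF p]
      by (intro closed) (unfold tail_equiv_def, blast)
  moreover have "case_nat \<alpha> p \<in> c" if "\<alpha> \<in> arcs Q" "head Q \<alpha> = tail Q (p 0)" for \<alpha>
  proof -
    have "path_tail 0 p = path_tail (Suc 0) (case_nat \<alpha> p)"
      by (simp add: path_tail_def)
    then show ?thesis
      using p that case_nat_in_inf_paths[of \<alpha> p Q]
      by (intro closed) (unfold tail_equiv_def, blast)
  qed
  ultimately show ?thesis
    using assms(1,2) by (cases g) (auto simp: lpa_gens_def)
qed

lemma lpa_operators_F:
  "lpa_operators (inf_basis_act Q :: _ \<Rightarrow> _ \<Rightarrow> (_ \<Rightarrow>\<^sub>0 'k::field)) Q (basis_span (inf_paths Q))"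
proof (rule lpa_basis_operators.lpa_operatorsI)
  interpret b: lpa_basis_operators "inf_basis_act Q :: _ \<Rightarrow> _ \<Rightarrow> (_ \<Rightarrow>\<^sub>0 'k)" .
  show "inf_basis_act Q g p \<in> basis_span (inf_paths Q)" if "g \<in> lpa_gens Q" "p \<in> inf_paths Q" for g p
    using that
    by (cases g) (auto simp: lpa_gens_def path_tail_in_inf_paths case_nat_in_inf_paths)
  show "b.ev r (Poly_Mapping.single p 1) = 0"
    if r: "r \<in> lpa_relators Q" and p: "p \<in> inf_paths Q" for r p
  proof -
    note ev = b.ev_minus_left b.ev_mult b.ev_gen b.ev_sum_left
    have p0: "p 0 \<in> arcs Q" "head Q (p 0) = tail Q (path_tail (Suc 0) p 0)"
      using p by (auto simp: inf_paths_def path_tail_def)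
    show ?thesis
      using r
    proof cases
      case (regular i)
      have "(\<Sum>\<alpha>\<in>out_arcs Q i. b.ops (Ghost \<alpha>) (b.ops (Arrow \<alpha>) (Poly_Mapping.single p 1)))
        = (\<Sum>\<alpha>\<in>out_arcs Q i. if \<alpha> = p 0 then Poly_Mapping.single p (1::'k) else 0)"
        using p0 by (intro sum.cong) auto
      then show ?thesis
        using regular p0 by (auto simp: ev regular_verts_def)
    qed (use p0 in \<open>auto simp: ev eval_free_def[of _ 0]\<close>)
  qed
qed

lemma subrepresentation_F:
  assumes "c \<in> inf_paths Q // tail_equiv Q"
  shows "subrepresentation (leavitt_path_algebra Q) (F_rep Q) (basis_span c)"
proof -
  interpret lpa_operators "inf_basis_act Q" Q "basis_span (inf_paths Q)"
    by (rule lpa_operators_F)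
  have "lin_ext (inf_basis_act Q g) v \<in> basis_span c"
    if "g \<in> lpa_gens Q" "v \<in> basis_span c" for g v
    using that assms by (intro lin_ext_in_subspace subspace_basis_span inf_basis_act_closed)
      (auto simp: basis_span_iff)
  moreover have "c \<subseteq> inf_paths Q"
    using equiv_tail_equiv assms by (rule in_quotient_imp_subset)
  then have "basis_span c \<subseteq> basis_span (inf_paths Q)"
    unfolding subset_iff basis_span_iff by blast
  ultimately show ?thesis
    unfolding F_rep_def
    by (intro invariant_imp_subrepresentation subspace_basis_span)
qed

end

theory Submission
  imports Defs
begin

text \<open>
  Everything is read off from the action of the vertex \<open>i\<close> at a sink \<open>i\<close>. A path starting at \<open>i\<close> is
  trivial, so this vertex projects \<open>\<N>\<^sub>i\<close> onto the line spanned by the trivial path \<open>e\<^sub>i\<close>, and it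
  annihilates \<open>\<N>\<^sub>j\<close> for \<open>j \<noteq> i\<close> as well as all of \<open>\<F>\<close>; hence the non-isomorphisms. A nonzero
  invariant subspace of \<open>\<N>\<^sub>i\<close> contains \<open>e\<^sub>i\<close> (strip arrows off a path in the support, then
  project) and therefore every path (prepend arrows with the ghosts). An endomorphism maps \<open>e\<^sub>i\<close>
  into its line, so it has an eigenvector, and its eigenspace is everything by irreducibility.
\<close>

section \<open>Representations of algebras\<close>

lemma is_representation_act_lin_maps:
  assumes "is_representation A M" "a \<in> alg_carrier A"
  shows "rep_act M a \<in> lin_maps (rep_scale M) (rep_space M) (rep_scale M) (rep_space M)"
  using assms by (auto simp: is_representation_def alg_hom_def End_algebra_def)

text \<open>The homomorphism equations for \<open>rep_act M\<close> hold pointwise on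
  \<open>rep_space M\<close>, hence on \<open>W\<close>; invariance of \<open>W\<close> makes the
  composite of two restrictions the restriction of the composite.\<close>

lemma is_representation_subrep:
  assumes sub: "subrepresentation A M W"
  shows "is_representation A (subrep M W)"
proof -
  let ?s = "rep_scale M" and ?V = "rep_space M" and ?r = "rep_act M"
  have M: "is_representation A M" and W: "module.subspace ?s W" "W \<subseteq> ?V"
    and inv: "\<And>a w. \<lbrakk>a \<in> alg_carrier A; w \<in> W\<rbrakk> \<Longrightarrow> ?r a w \<in> W"
    using sub by (auto simp: subrepresentation_def)
  have vs: "vector_space ?s" and hom: "?r \<in> alg_hom A (End_algebra ?s ?V)"
    using M by (auto simp: is_representation_def)
  have "restrict (?r a) W \<in> lin_maps ?s W ?s W" if a: "a \<in> alg_carrier A" for a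
  proof -
    interpret vector_space ?s by fact
    have "subspace W" using W(1) .
    then show ?thesis
      using is_representation_act_lin_maps[OF M a] inv[OF a] W(2)
      by (auto simp: lin_maps_def subset_iff subspace_add subspace_scale)
  qed
  then have "(\<lambda>a. restrict (?r a) W) \<in> alg_hom A (End_algebra ?s W)"
    using hom W(2) inv
    by (auto simp: alg_hom_def End_algebra_def compose_def subset_iff intro!: restrict_ext)
  then show ?thesis
    using vs W(1) by (simp add: is_representation_def subrep_def)
qed

lemma rep_isomorphic_refl:
  assumes "is_representation A M"
  shows "rep_isomorphic A M M"
proof -
  interpret vector_space "rep_scale M"
    using assms by (simp add: is_representation_def)
  have "subspace (rep_space M)"
    using assms by (simp add: is_representation_def)
  moreover have "rep_act M a x \<in> rep_space M" if "a \<in> alg_carrier A" "x \<in> rep_space M" for a x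
    using is_representation_act_lin_maps[OF assms that(1)] that(2) by (auto simp: lin_maps_def)
  \<comment> \<open>The identity must be restricted because \<open>lin_maps\<close> contains only
    extensional functions.\<close>
  ultimately have "restrict id (rep_space M) \<in> rep_hom A M M"
    by (auto simp: rep_hom_def lin_maps_def subspace_add subspace_scale)
  moreover have "bij_betw (restrict id (rep_space M)) (rep_space M) (rep_space M)"
    by (simp add: bij_betw_def inj_on_def)
  ultimately show ?thesis
    unfolding rep_isomorphic_def by blast
qed

text \<open>The annihilator is an isomorphism invariant, and this is what tells the representations
  apart: write \<open>y = f x\<close>; then \<open>a\<close> sends \<open>y\<close> to
  \<open>f (rep_act M a x) = f 0 = 0\<close>.\<close>

lemma rep_isomorphic_act_zero:
  assumes iso: "rep_isomorphic A M N" and M: "is_representation A M"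
    and a: "a \<in> alg_carrier A" and zero: "\<And>x. x \<in> rep_space M \<Longrightarrow> rep_act M a x = 0"
    and y: "y \<in> rep_space N"
  shows "rep_act N a y = 0"
proof -
  interpret vector_space "rep_scale M"
    using M by (simp add: is_representation_def)
  have "subspace (rep_space M)"
    using M by (simp add: is_representation_def)
  then have 0: "0 \<in> rep_space M" by (rule subspace_0)
  obtain f where f: "f \<in> rep_hom A M N" "f ` rep_space M = rep_space N"
    using iso by (auto simp: rep_isomorphic_def bij_betw_def)
  have "f (0 + 0) = f 0 + f 0"
    using f(1) 0 unfolding rep_hom_def lin_maps_def by blast
  then have f0: "f 0 = 0" by simp
  obtain x where x: "x \<in> rep_space M" "y = f x"
    using y f(2) by blast
  then have "f (rep_act M a x) = rep_act N a y"
    using f(1) a by (simp add: rep_hom_def)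
  then show ?thesis
    using zero[OF x(1)] f0 by simp
qed

text \<open>Schur's lemma over an arbitrary field: the eigenvector is supplied as a hypothesis
  instead of coming from algebraic closedness.\<close>

lemma irreducible_rep_eigenvector_scalar:
  assumes irr: "irreducible_rep A M" and f: "f \<in> rep_hom A M M"
    and x0: "x0 \<in> rep_space M" "x0 \<noteq> 0" "f x0 = rep_scale M c x0"
  shows "f = restrict (rep_scale M c) (rep_space M)"
proof -
  let ?s = "rep_scale M" and ?V = "rep_space M"
  have M: "is_representation A M"
    using irr by (simp add: irreducible_rep_def)
  interpret vector_space ?s
    using M by (simp add: is_representation_def)
  have V: "subspace ?V"
    using M by (simp add: is_representation_def)
  have f_ext: "f \<in> extensional ?V"
    and f_add: "\<And>x y. \<lbrakk>x \<in> ?V; y \<in> ?V\<rbrakk> \<Longrightarrow> f (x + y) = f x + f y"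
    and f_scale: "\<And>d x. x \<in> ?V \<Longrightarrow> f (?s d x) = ?s d (f x)"
    and f_act: "\<And>a x. \<lbrakk>a \<in> alg_carrier A; x \<in> ?V\<rbrakk> \<Longrightarrow> f (rep_act M a x) = rep_act M a (f x)"
    using f by (auto simp: rep_hom_def lin_maps_def PiE_def)
  define W where "W = {x \<in> ?V. f x = ?s c x}"
  \<comment> \<open>Both sides are 0, by homogeneity of \<open>f\<close> at \<open>x0\<close> with
    factor 0; this puts 0 into the eigenspace.\<close>
  have "f 0 = ?s c 0"
    using f_scale[OF x0(1), of 0] by simp
  then have "subspace W"
    using V by (auto simp: W_def subspace_def f_add f_scale scale_right_distrib scale_left_commute)
  moreover have "rep_act M a w \<in> W" if "a \<in> alg_carrier A" "w \<in> W" for a w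
    using is_representation_act_lin_maps[OF M that(1)] that
    by (auto simp: W_def lin_maps_def f_act)
  ultimately have "subrepresentation A M W"
    using M by (auto simp: subrepresentation_def W_def)
  moreover have "x0 \<in> W"
    using x0 by (simp add: W_def)
  ultimately have "W = ?V"
    using irr x0(2) unfolding irreducible_rep_def by blast
  then have "f x = ?s c x" if "x \<in> ?V" for x
    using that by (auto simp: W_def)
  \<comment> \<open>Outside the space both functions are \<open>undefined\<close>, so agreement on
    it is equality.\<close>
  then show ?thesis
    using f_ext by (auto simp: fun_eq_iff extensional_def)
qed

lemma scalar_in_rep_hom:
  assumes "is_representation A M"
  shows "restrict (rep_scale M c) (rep_space M) \<in> rep_hom A M M"
proof -
  interpret vector_space "rep_scale M"
    using assms by (simp add: is_representation_def)
  have "subspace (rep_space M)"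
    using assms by (simp add: is_representation_def)
  moreover have "rep_act M a x \<in> rep_space M"
    "rep_act M a (rep_scale M c x) = rep_scale M c (rep_act M a x)"
    if "a \<in> alg_carrier A" "x \<in> rep_space M" for a x
    using is_representation_act_lin_maps[OF assms that(1)] that(2) by (auto simp: lin_maps_def)
  ultimately show ?thesis
    by (auto simp: rep_hom_def lin_maps_def subspace_add subspace_scale scale_right_distrib
        scale_left_commute)
qed

text \<open>Every endomorphism is scalar by the previous eigenvector argument, so the scalars
  \<open>g\<close> map the field bijectively onto the endomorphisms; the isomorphism sought is
  \<open>inv g\<close>.\<close>

lemma irreducible_rep_End_field:
  fixes A :: "('k::field, 'x) kalgebra" and M :: "('k, 'x, 'm::ab_group_add) rep"
  assumes irr: "irreducible_rep A M"
    and eigen: "\<And>f. f \<in> rep_hom A M M \<Longrightarrow>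
      \<exists>x\<in>rep_space M. \<exists>c. x \<noteq> 0 \<and> f x = rep_scale M c x"
  shows "alg_isomorphic (End_rep A M) field_algebra"
proof -
  let ?V = "rep_space M"
  have M: "is_representation A M"
    using irr by (simp add: irreducible_rep_def)
  interpret vector_space "rep_scale M"
    using M by (simp add: is_representation_def)
  have V: "subspace ?V"
    using M by (simp add: is_representation_def)
  define g where "g c = restrict (rep_scale M c) ?V" for c
  \<comment> \<open>Any scalar endomorphism has an eigenvector by \<open>eigen\<close>, which
    provides a nonzero vector.\<close>
  have "\<exists>x\<in>?V. x \<noteq> 0"
    using eigen[OF scalar_in_rep_hom[OF M]] by blast
  then obtain x0 where x0: "x0 \<in> ?V" "x0 \<noteq> 0" by blast
  have "inj g"
    using x0 by (intro injI) (auto simp: g_def fun_eq_iff restrict_def dest!: spec[of _ x0])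
  moreover have range: "range g = rep_hom A M M"
  proof
    show "range g \<subseteq> rep_hom A M M"
      unfolding g_def using scalar_in_rep_hom[OF M] by (rule image_subsetI)
    show "rep_hom A M M \<subseteq> range g"
    proof
      fix f assume f: "f \<in> rep_hom A M M"
      then obtain x c where "x \<in> ?V" "x \<noteq> 0" "f x = rep_scale M c x"
        using eigen by blast
      then have "f = g c"
        unfolding g_def by (rule irreducible_rep_eigenvector_scalar[OF irr f])
      then show "f \<in> range g" by blast
    qed
  qed
  ultimately have "bij_betw g UNIV (rep_hom A M M)"
    by (simp add: bij_betw_def)
  then have bij: "bij_betw (inv g) (rep_hom A M M) UNIV"
    by (rule bij_betw_inv_into)
  have g_add: "(\<lambda>x\<in>?V. g c x + g d x) = g (c + d)"
    and g_scale: "(\<lambda>x\<in>?V. rep_scale M c (g d x)) = g (c * d)"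
    and g_mult: "compose ?V (g c) (g d) = g (c * d)" for c d
    using V by (auto simp: g_def fun_eq_iff compose_def scale_left_distrib subspace_scale)
  \<comment> \<open>Rewriting the carrier as \<open>range g\<close> turns each endomorphism into
    some \<open>g c\<close>, where \<open>inv g\<close> returns \<open>c\<close>.\<close>
  have "inv g \<in> alg_hom (End_rep A M) field_algebra"
    using \<open>inj g\<close>
    by (auto simp: alg_hom_def End_rep_def End_algebra_def field_algebra_def g_add g_scale g_mult
        simp flip: range)
  with bij show ?thesis
    by (auto simp: alg_isomorphic_def End_rep_def field_algebra_def End_algebra_def)
qed

section \<open>The action of the generators\<close>

lemma gen_class_in_lpa:
  "g \<in> lpa_gens Q \<Longrightarrow> lpa_rel Q `` {gen g} \<in> alg_carrier (leavitt_path_algebra Q)"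
  by (simp add: leavitt_path_algebra_def quotientI gen_in_free_carrier)

lemma N_space_subset:
  assumes "i \<in> sinks Q"
  shows "N_space Q i \<subseteq> basis_span (\<Union>i\<in>sinks Q. paths_to Q i)"
  using assms unfolding N_space_def subset_iff basis_span_iff by blast

text \<open>Replaces the action of a residue class, defined through \<open>the_elem\<close>, by the
  explicit formula on basis paths.\<close>

lemma N_act_gen:
  assumes "wf_digraph Q" "i \<in> sinks Q" "g \<in> lpa_gens Q" "v \<in> N_space Q i"
  shows "rep_act (N_rep Q) (lpa_rel Q `` {gen g}) v = lin_ext (fin_basis_act Q g) v"
  using lpa_operators.rep_act_gen[OF lpa_operators_N[OF assms(1)] assms(3)]
    N_space_subset[OF assms(2)] assms(4) unfolding N_rep_def by blast

lemma lookup_lin_ext: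
  "Poly_Mapping.lookup (lin_ext b f) y =
    (\<Sum>x\<in>Poly_Mapping.keys f. Poly_Mapping.lookup f x * Poly_Mapping.lookup (b x) y)"
  by (simp add: lin_ext_def lookup_sum)

text \<open>Rules out cancellation: \<open>z\<close> is the only basis element of the support that
  can contribute to the coefficient at \<open>y\<close>.\<close>

lemma lookup_lin_ext_eq:
  assumes "\<And>x. x \<in> Poly_Mapping.keys f \<Longrightarrow>
    Poly_Mapping.lookup (b x) y = (if x = z then 1 else 0)"
  shows "Poly_Mapping.lookup (lin_ext b f) y = Poly_Mapping.lookup f z"
proof -
  have "Poly_Mapping.lookup (lin_ext b f) y =
      (\<Sum>x\<in>Poly_Mapping.keys f. if x = z then Poly_Mapping.lookup f x else 0)"
    unfolding lookup_lin_ext by (rule sum.cong) (simp_all add: assms)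
  \<comment> \<open>If \<open>z\<close> is outside the support, the sum is empty of nonzero terms
    and \<open>lookup f z\<close> is 0 as well.\<close>
  then show ?thesis
    by (simp add: in_keys_iff)
qed

text \<open>A nontrivial path would have a first arrow starting at the sink; a trivial path ends
  where it starts.\<close>

lemma paths_to_from_sink:
  assumes "wf_digraph Q" "i \<in> sinks Q" "(i, p) \<in> paths_to Q j"
  shows "p = [] \<and> j = i"
  using assms(2,3) wf_digraph.awalk_Cons_iff[OF assms(1)] pre_digraph.awalk_def
  by (cases p) (auto simp: paths_to_def sinks_def out_arcs_def wf_digraph.awalk_Nil_iff[OF assms(1)])

lemma sink_vertex_act_N_space:
  assumes "wf_digraph Q" "i \<in> sinks Q" "v \<in> N_space Q i"
  shows "lin_ext (fin_basis_act Q (Vertex i)) v =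
    Poly_Mapping.single (i, []) (Poly_Mapping.lookup v (i, []))"
proof (rule poly_mapping_eqI)
  fix y
  have keys: "Poly_Mapping.keys v \<subseteq> paths_to Q i"
    using assms(3) by (simp add: N_space_def basis_span_iff)
  have act: "fin_basis_act Q (Vertex i) x =
      (if x = (i, []) then Poly_Mapping.single x 1 else 0 :: _ \<Rightarrow>\<^sub>0 'c)"
    if "x \<in> Poly_Mapping.keys v" for x
    using that keys paths_to_from_sink[OF assms(1,2)] by (cases x) auto
  have "Poly_Mapping.lookup (lin_ext (fin_basis_act Q (Vertex i)) v) y
      = (\<Sum>x\<in>Poly_Mapping.keys v. if x = (i, []) then
          (if y = (i, []) then Poly_Mapping.lookup v (i, []) else 0) else 0)"
    unfolding lookup_lin_ext by (rule sum.cong) (auto simp: act lookup_single when_def)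
  then show "Poly_Mapping.lookup (lin_ext (fin_basis_act Q (Vertex i)) v) y =
      Poly_Mapping.lookup (Poly_Mapping.single (i, []) (Poly_Mapping.lookup v (i, []))) y"
    by (auto simp: lookup_single when_def in_keys_iff)
qed

text \<open>The vertex keeps only paths starting at \<open>i\<close>, but such a path would be
  trivial and could not end at \<open>j\<close>.\<close>

lemma sink_vertex_act_N_space_other:
  assumes "wf_digraph Q" "i \<in> sinks Q" "i \<noteq> j" "v \<in> N_space Q j"
  shows "lin_ext (fin_basis_act Q (Vertex i)) v = 0"
  unfolding lin_ext_def
proof (rule sum.neutral, rule ballI)
  fix x assume "x \<in> Poly_Mapping.keys v"
  then have "x \<in> paths_to Q j"
    using assms(4) by (auto simp: N_space_def basis_span_iff)
  then show "pm_scale (Poly_Mapping.lookup v x) (fin_basis_act Q (Vertex i) x) = 0"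
    using paths_to_from_sink[OF assms(1,2)] assms(3) by (cases x) auto
qed

text \<open>A left-infinite path always has a first arrow, so it cannot start at a sink.\<close>

lemma sink_vertex_act_F:
  assumes "i \<in> sinks Q" "v \<in> basis_span (inf_paths Q)"
  shows "lin_ext (inf_basis_act Q (Vertex i)) v = 0"
  unfolding lin_ext_def
proof (rule sum.neutral, rule ballI)
  fix p assume "p \<in> Poly_Mapping.keys v"
  then have "p 0 \<in> arcs Q"
    using assms(2) by (auto simp: basis_span_iff inf_paths_def)
  then show "pm_scale (Poly_Mapping.lookup v p) (inf_basis_act Q (Vertex i) p) = 0"
    using assms(1) by (auto simp: sinks_def out_arcs_def)
qed

section \<open>Irreducibility\<close>

lemma single_one_neq_zero: "Poly_Mapping.single x (1::'k::field) \<noteq> 0"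
  by (metis keys_single keys_zero insert_not_empty zero_neq_one)

lemma trivial_path_in_N_space:
  assumes "wf_digraph Q" "i \<in> sinks Q"
  shows "Poly_Mapping.single (i, []) 1 \<in> N_space Q i"
  using assms by (simp add: N_space_def paths_to_def sinks_def wf_digraph.awalk_Nil_iff)

text \<open>Induction on one path in the support. The vector \<open>f\<close> is generalised because
  stripping an arrow replaces it by its image under that arrow.\<close>

lemma invariant_contains_trivial_path:
  fixes W :: "('v \<times> 'a list \<Rightarrow>\<^sub>0 'k::field) set"
  assumes Q: "wf_digraph Q" and i: "i \<in> sinks Q"
    and W: "pm.subspace W" "W \<subseteq> N_space Q i"
    and inv: "\<And>g v. \<lbrakk>g \<in> lpa_gens Q; v \<in> W\<rbrakk> \<Longrightarrow> lin_ext (fin_basis_act Q g) v \<in> W"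
    and f: "f \<in> W" "(u, p) \<in> Poly_Mapping.keys f"
  shows "Poly_Mapping.single (i, []) 1 \<in> W"
  using f
proof (induction p arbitrary: u f)
  case Nil
  let ?c = "Poly_Mapping.lookup f (i, [])"
  \<comment> \<open>A trivial path ending at \<open>i\<close> sits at \<open>i\<close>, so
    \<open>u = i\<close> and the coefficient kept by the projection is nonzero.\<close>
  have "(u, []) \<in> paths_to Q i"
    using Nil W(2) by (auto simp: N_space_def basis_span_iff subset_iff)
  then have c: "?c \<noteq> 0"
    using Nil(2) by (simp add: paths_to_def wf_digraph.awalk_Nil_iff[OF Q] in_keys_iff)
  have "Vertex i \<in> lpa_gens Q"
    using i by (simp add: lpa_gens_def sinks_def)
  then have "Poly_Mapping.single (i, []) ?c \<in> W"
    using inv[OF _ Nil(1)] sink_vertex_act_N_space[OF Q i] Nil(1) W(2) by (metis subsetD)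
  then have "pm_scale (inverse ?c) (Poly_Mapping.single (i, []) ?c) \<in> W"
    by (rule pm.subspace_scale[OF W(1)])
  also have "pm_scale (inverse ?c) (Poly_Mapping.single (i, []) ?c) = Poly_Mapping.single (i, []) 1"
    using c by (auto intro!: poly_mapping_eqI simp: lookup_single when_def)
  finally show ?case .
next
  case (Cons \<alpha> p)
  have keys: "Poly_Mapping.keys f \<subseteq> paths_to Q i"
    using Cons.prems(1) W(2) by (auto simp: N_space_def simp flip: basis_span_iff)
  then have "(u, \<alpha> # p) \<in> paths_to Q i"
    using Cons.prems by blast
  then have \<alpha>: "\<alpha> \<in> arcs Q" "u = tail Q \<alpha>"
    by (auto simp: paths_to_def wf_digraph.awalk_Cons_iff[OF Q])
  \<comment> \<open>Only a path with arrow list \<open>\<alpha> # p\<close> is sent to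
    \<open>(head Q \<alpha>, p)\<close>, and being a path it must start at
    \<open>tail Q \<alpha> = u\<close>. Hence the coefficient survives.\<close>
  have "Poly_Mapping.lookup (lin_ext (fin_basis_act Q (Arrow \<alpha>)) f) (head Q \<alpha>, p)
      = Poly_Mapping.lookup f (u, \<alpha> # p)"
  proof (rule lookup_lin_ext_eq)
    fix x assume "x \<in> Poly_Mapping.keys f"
    then have x: "x \<in> paths_to Q i" using keys by blast
    obtain w q where xq: "x = (w, q)" by force
    show "Poly_Mapping.lookup (fin_basis_act Q (Arrow \<alpha>) x) (head Q \<alpha>, p)
        = (if x = (u, \<alpha> # p) then 1 else 0 :: 'k)"
      using x \<alpha>(2)
      by (cases q) (auto simp: xq paths_to_def wf_digraph.awalk_Cons_iff[OF Q] lookup_single when_def)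
  qed
  then have "(head Q \<alpha>, p) \<in> Poly_Mapping.keys (lin_ext (fin_basis_act Q (Arrow \<alpha>)) f)"
    using Cons.prems(2) by (simp add: in_keys_iff)
  moreover have "lin_ext (fin_basis_act Q (Arrow \<alpha>)) f \<in> W"
    using \<alpha>(1) Cons.prems(1) by (intro inv) (simp_all add: lpa_gens_def)
  ultimately show ?case
    by (intro Cons.IH)
qed

lemma invariant_contains_path:
  assumes Q: "wf_digraph Q"
    and e: "Poly_Mapping.single (i, []) (1::'k::field) \<in> W"
    and inv: "\<And>g v. \<lbrakk>g \<in> lpa_gens Q; v \<in> W\<rbrakk> \<Longrightarrow> lin_ext (fin_basis_act Q g) v \<in> W"
    and p: "(u, p) \<in> paths_to Q i"
  shows "Poly_Mapping.single (u, p) 1 \<in> W"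
  using p
proof (induction p arbitrary: u)
  case Nil
  then show ?case
    using e by (simp add: paths_to_def wf_digraph.awalk_Nil_iff[OF Q])
next
  case (Cons \<alpha> p)
  then have \<alpha>: "\<alpha> \<in> arcs Q" "u = tail Q \<alpha>" "(head Q \<alpha>, p) \<in> paths_to Q i"
    by (auto simp: paths_to_def wf_digraph.awalk_Cons_iff[OF Q])
  \<comment> \<open>The ghost prepends \<alpha>, since the remaining path starts at its
    head.\<close>
  then have "lin_ext (fin_basis_act Q (Ghost \<alpha>)) (Poly_Mapping.single (head Q \<alpha>, p) 1) \<in> W"
    by (intro inv Cons.IH) (simp_all add: lpa_gens_def)
  then show ?case
    using \<alpha>(2) by simp
qed

lemma irreducible_N_space:
  fixes Q :: "('v, 'a) pre_digraph"
  assumes Q: "wf_digraph Q" and i: "i \<in> sinks Q"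
  shows "irreducible_rep (leavitt_path_algebra Q :: ('k::field, _) kalgebra)
    (subrep (N_rep Q) (N_space Q i))"
  unfolding irreducible_rep_def
proof (intro conjI allI impI)
  let ?L = "leavitt_path_algebra Q :: ('k, _) kalgebra"
  let ?N = "N_space Q i :: (_ \<Rightarrow>\<^sub>0 'k) set"
  show "is_representation ?L (subrep (N_rep Q) ?N)"
    by (rule is_representation_subrep[OF subrepresentation_N[OF Q i]])
  have "Poly_Mapping.single (i, []) (1::'k) \<noteq> (0 :: 'v \<times> 'a list \<Rightarrow>\<^sub>0 'k)"
    by (simp add: single_one_neq_zero)
  then show "rep_space (subrep (N_rep Q) ?N) \<noteq> {0}"
    using trivial_path_in_N_space[OF Q i] unfolding subrep_def by force
  fix W assume sub: "subrepresentation ?L (subrep (N_rep Q) ?N) W"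
  then have W: "pm.subspace W" "W \<subseteq> ?N"
    by (auto simp: subrepresentation_def subrep_def N_rep_def lpa_rep_def)
  \<comment> \<open>Invariance under the whole algebra is specialised to the classes of the
    generators, the form used by the two lemmas on invariant subspaces.\<close>
  have inv: "lin_ext (fin_basis_act Q g) v \<in> W" if g: "g \<in> lpa_gens Q" and v: "v \<in> W" for g v
  proof -
    have "rep_act (subrep (N_rep Q) ?N) (lpa_rel Q `` {gen g}) v \<in> W"
      using sub gen_class_in_lpa[OF g] v unfolding subrepresentation_def by blast
    then show ?thesis
      using N_act_gen[OF Q i g, of v] v W(2) by (auto simp: subrep_def)
  qed
  show "W = {0} \<or> W = rep_space (subrep (N_rep Q) ?N)"
  proof (cases "W = {0}")
    case False
    then obtain f where f: "f \<in> W" "f \<noteq> 0"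
      using pm.subspace_0[OF W(1)] by blast
    then obtain u p where "(u, p) \<in> Poly_Mapping.keys f"
      by (metis all_not_in_conv keys_eq_empty surj_pair)
    then have "Poly_Mapping.single (i, []) 1 \<in> W"
      using invariant_contains_trivial_path[OF Q i W inv f(1)] by blast
    then have "(\<lambda>x. Poly_Mapping.single x 1) ` paths_to Q i \<subseteq> W"
      using invariant_contains_path[OF Q _ inv] by auto
    then have "?N \<subseteq> W"
      unfolding N_space_def basis_span_def using W(1) by (rule pm.span_minimal)
    then show ?thesis
      using W(2) by (auto simp: subrep_def)
  qed simp
qed

section \<open>Endomorphisms and non-isomorphism\<close>

lemma End_N_space:
  fixes Q :: "('v, 'a) pre_digraph"
  assumes Q: "wf_digraph Q" and i: "i \<in> sinks Q"
  shows "alg_isomorphic (End_rep (leavitt_path_algebra Q :: ('k::field, _) kalgebra)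
    (subrep (N_rep Q) (N_space Q i))) field_algebra"
proof (rule irreducible_rep_End_field[OF irreducible_N_space[OF Q i]])
  let ?L = "leavitt_path_algebra Q :: ('k, _) kalgebra"
  let ?M = "subrep (N_rep Q) (N_space Q i) :: ('k, _, _) rep"
  let ?e = "Poly_Mapping.single (i, []) 1 :: 'v \<times> 'a list \<Rightarrow>\<^sub>0 'k"
  fix f assume f: "f \<in> rep_hom ?L ?M ?M"
  have e: "?e \<in> N_space Q i"
    by (rule trivial_path_in_N_space[OF Q i])
  have fe: "f ?e \<in> N_space Q i"
    using f e by (auto simp: rep_hom_def lin_maps_def subrep_def)
  have gen: "Vertex i \<in> lpa_gens Q"
    using i by (simp add: lpa_gens_def sinks_def)
  \<comment> \<open>The vertex \<open>i\<close> fixes \<open>?e\<close>, so it also fixes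
    \<open>f ?e\<close>; its image is the line through \<open>?e\<close>, and the eigenvalue is the
    coefficient of \<open>f ?e\<close> at the trivial path.\<close>
  have "f (rep_act ?M (lpa_rel Q `` {gen (Vertex i)}) ?e)
      = rep_act ?M (lpa_rel Q `` {gen (Vertex i)}) (f ?e)"
    using f gen_class_in_lpa[OF gen] e unfolding rep_hom_def by (auto simp: subrep_def)
  then have "f ?e = lin_ext (fin_basis_act Q (Vertex i)) (f ?e)"
    using N_act_gen[OF Q i gen e] N_act_gen[OF Q i gen fe] e fe by (simp add: subrep_def)
  also have "\<dots> = pm_scale (Poly_Mapping.lookup (f ?e) (i, [])) ?e"
    unfolding sink_vertex_act_N_space[OF Q i fe]
    by (auto intro!: poly_mapping_eqI simp: lookup_single when_def)
  finally have "f ?e = pm_scale (Poly_Mapping.lookup (f ?e) (i, [])) ?e" .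
  moreover have "?e \<noteq> 0"
    by (simp add: single_one_neq_zero)
  ultimately show "\<exists>x\<in>rep_space ?M. \<exists>c. x \<noteq> 0 \<and> f x = rep_scale ?M c x"
    using e by (auto simp: subrep_def N_rep_def lpa_rep_def)
qed

text \<open>An isomorphism would carry the vanishing of the vertex \<open>i\<close> over to
  \<open>N_space Q i\<close>, where it fixes the nonzero trivial path. \<open>M\<close> is left
  general to cover both finite and left-infinite paths.\<close>

lemma not_rep_isomorphic_N_space:
  fixes Q :: "('v, 'a) pre_digraph"
    and M :: "('k::field, ('v, 'a, 'k) free_lpa set, 'm::ab_group_add) rep"
  assumes Q: "wf_digraph Q" and i: "i \<in> sinks Q"
    and M: "is_representation (leavitt_path_algebra Q) M"
    and zero: "\<And>x. x \<in> rep_space M \<Longrightarrow> rep_act M (lpa_rel Q `` {gen (Vertex i)}) x = 0"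
  shows "\<not> rep_isomorphic (leavitt_path_algebra Q) M (subrep (N_rep Q) (N_space Q i))"
proof
  let ?e = "Poly_Mapping.single (i, []) 1 :: 'v \<times> 'a list \<Rightarrow>\<^sub>0 'k"
  assume iso: "rep_isomorphic (leavitt_path_algebra Q) M (subrep (N_rep Q) (N_space Q i))"
  have gen: "Vertex i \<in> lpa_gens Q"
    using i by (simp add: lpa_gens_def sinks_def)
  have e: "?e \<in> N_space Q i"
    by (rule trivial_path_in_N_space[OF Q i])
  have "lin_ext (fin_basis_act Q (Vertex i)) ?e = 0"
    using rep_isomorphic_act_zero[OF iso M gen_class_in_lpa[OF gen] zero, of ?e] e
      N_act_gen[OF Q i gen e] by (simp add: subrep_def)
  then show False
    by (simp add: single_one_neq_zero)
qed

theorem theorem3p5: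
  fixes Q :: "('v, 'a) pre_digraph"
    and L :: "('k::field, ('v, 'a, 'k) free_lpa set) kalgebra"
    and N :: "('k, ('v, 'a, 'k) free_lpa set, 'v \<times> 'a list \<Rightarrow>\<^sub>0 'k) rep"
    and F :: "('k, ('v, 'a, 'k) free_lpa set, (nat \<Rightarrow> 'a) \<Rightarrow>\<^sub>0 'k) rep"
  assumes "wf_digraph Q"
  defines "L \<equiv> leavitt_path_algebra Q"
    and "N \<equiv> N_rep Q"
    and "F \<equiv> F_rep Q"
  shows "(\<forall>i\<in>sinks Q.
            subrepresentation L N (N_space Q i) \<and>
            irreducible_rep L (subrep N (N_space Q i)) \<and>
            alg_isomorphic (End_rep L (subrep N (N_space Q i))) field_algebra) \<and>
         (\<forall>i\<in>sinks Q. \<forall>j\<in>sinks Q.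
            rep_isomorphic L (subrep N (N_space Q i)) (subrep N (N_space Q j)) \<longleftrightarrow> i = j) \<and>
         (\<forall>c\<in>inf_paths Q // tail_equiv Q. \<forall>i\<in>sinks Q.
            \<not> rep_isomorphic L (subrep F (basis_span c)) (subrep N (N_space Q i)))"
proof (intro conjI ballI)
  note Q = \<open>wf_digraph Q\<close>
  have repN: "is_representation L (subrep N (N_space Q i))" if "i \<in> sinks Q" for i
    unfolding L_def N_def by (rule is_representation_subrep[OF subrepresentation_N[OF Q that]])
  have gen: "Vertex i \<in> lpa_gens Q" if "i \<in> sinks Q" for i
    using that by (simp add: lpa_gens_def sinks_def)
  fix i assume i: "i \<in> sinks Q"
  show "subrepresentation L N (N_space Q i)"
    unfolding L_def N_def by (rule subrepresentation_N[OF Q i])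
  show "irreducible_rep L (subrep N (N_space Q i))"
    unfolding L_def N_def by (rule irreducible_N_space[OF Q i])
  show "alg_isomorphic (End_rep L (subrep N (N_space Q i))) field_algebra"
    unfolding L_def N_def by (rule End_N_space[OF Q i])
  show "rep_isomorphic L (subrep N (N_space Q i)) (subrep N (N_space Q j)) \<longleftrightarrow> i = j"
    if j: "j \<in> sinks Q" for j
  proof (cases "i = j")
    case True
    then show ?thesis
      using rep_isomorphic_refl[OF repN[OF i]] by simp
  next
    case False
    \<comment> \<open>The vertex of the target sink \<open>j\<close> is the separating element: it
      kills the source but not the target.\<close>
    have "rep_act (subrep N (N_space Q i)) (lpa_rel Q `` {gen (Vertex j)}) x = 0"
      if "x \<in> rep_space (subrep N (N_space Q i))" for x
      using that False N_act_gen[OF Q i gen[OF j], of x]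
        sink_vertex_act_N_space_other[OF Q j, of i x]
      by (simp add: subrep_def N_def)
    then show ?thesis
      using False not_rep_isomorphic_N_space[OF Q j, of "subrep N (N_space Q i)"] repN[OF i]
      unfolding L_def N_def by blast
  qed
next
  note Q = \<open>wf_digraph Q\<close>
  fix c i assume c: "c \<in> inf_paths Q // tail_equiv Q" and i: "i \<in> sinks Q"
  have gen: "Vertex i \<in> lpa_gens Q"
    using i by (simp add: lpa_gens_def sinks_def)
  have "is_representation L (subrep F (basis_span c))"
    unfolding L_def F_def by (rule is_representation_subrep[OF subrepresentation_F[OF c]])
  moreover have "rep_act (subrep F (basis_span c)) (lpa_rel Q `` {gen (Vertex i)}) x = 0"
    if x: "x \<in> rep_space (subrep F (basis_span c))" for x
  proof -
    \<comment> \<open>A tail class consists of left-infinite paths, so its span inherits the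
      vanishing of the sink vertex.\<close>
    have "c \<subseteq> inf_paths Q"
      using equiv_tail_equiv c by (rule in_quotient_imp_subset)
    then have "x \<in> basis_span (inf_paths Q)"
      using x by (auto simp: subrep_def basis_span_iff)
    then show ?thesis
      using lpa_operators.rep_act_gen[OF lpa_operators_F gen, of x] sink_vertex_act_F[OF i, of x] x
      by (simp add: subrep_def F_def F_rep_def)
  qed
  ultimately show "\<not> rep_isomorphic L (subrep F (basis_span c)) (subrep N (N_space Q i))"
    unfolding L_def N_def by (intro not_rep_isomorphic_N_space[OF Q i])
qed

end
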